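(* Let $m\in\mathbb{N}$. Then the following strict inclusions hold: (i) $c^G_0(\Delta^m_G)\subsetneq c^G_0(\Delta^{m+1}_G)$; (ii) $c^G(\Delta^m_G)\subsetneq c^G(\Delta^{m+1}_G)$; (iii) $l^G_\infty(\Delta^m_G)\subsetneq l^G_\infty(\Delta^{m+1}_G)$.
   Context: Geometric arithmetic: the map $z\mapsto e^z$ is used as a generator, i.e. it is treated as a bijection from $\mathbb{C}$ onto the set of geometric complex numbers $\mathbb{C}(G)=\{e^z:z\in\mathbb{C}\}$, with inverse $\ln$. Operations: $x\oplus y=e^{\ln x+\ln y}=xy$, $x\ominus y=e^{\ln x-\ln y}=x/y$, $x\odot y=e^{\ln x\cdot\ln y}$; the geometric zero is $1$ and the identity is $e$. Geometric modulus: $|e^z|^G=e^{|z|}\in[1,\infty)$, compared in the usual order of the reals. $\mathbb{N}=\{1,2,\dots\}$. $\omega(G)$ is the set of all sequences $x=(x_k)_{k\ge1}$ in $\mathbb{C}(G)$. Set $l_\infty^G=\{x\in\omega(G):\sup_k|x_k|^G<\infty\}$, $c^G=\{x\in\omega(G):|x_k\ominus l|^G\to1\text{ for some }l\in\mathbb{C}(G)\}$, $c_0^G=\{x\in\omega(G):|x_k|^G\to1\}$. Differences: $\Delta^0_Gx=x$, $\Delta_G^mx=(\Delta^m_Gx_k)_k$ with $\Delta^m_Gx_k=\Delta^{m-1}_Gx_k\ominus\Delta^{m-1}_Gx_{k+1}$. For $X\in\{l_\infty^G,c^G,c_0^G\}$, $X(\Delta^m_G)=\{x\in\omega(G):\Delta^m_Gx\in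 X\}$. *)

theory Defs imports Complex_Main begin

text \<open>
  The generator \<open>z \<mapsto> e^z\<close> of geometric arithmetic is treated as a bijection from the complex
  numbers onto the geometric complex numbers.  As a function into \<^typ>\<open>complex\<close>, \<^const>\<open>exp\<close> is not
  injective, so \<open>|e^z|\<^sup>G = e^|z|\<close> would be ill-defined there.  A geometric complex
  number \<open>e^z\<close> is therefore represented as \<open>GExp z\<close>, retaining its exponent \<open>z\<close>, with the true
  inverse \<open>gln\<close>; the underlying complex number is recovered by \<open>gval\<close>.
\<close>

datatype gcomplex = GExp (gln: complex)

definition gval :: "gcomplex \<Rightarrow> complex" where
  "gval x = exp (gln x)"

definition gplus :: "gcomplex \<Rightarrow> gcomplex \<Rightarrow> gcomplex" (infixl "\<oplus>" 65) where
  "x \<oplus> y = GExp (gln x + gln y)"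

definition gminus :: "gcomplex \<Rightarrow> gcomplex \<Rightarrow> gcomplex" (infixl "\<ominus>" 65) where
  "x \<ominus> y = GExp (gln x - gln y)"

definition gtimes :: "gcomplex \<Rightarrow> gcomplex \<Rightarrow> gcomplex" (infixl "\<odot>" 70) where
  "x \<odot> y = GExp (gln x * gln y)"

lemma bij_GExp: "bij GExp"
  by (rule bijI') (auto intro: gcomplex.collapse[symmetric])

lemma gval_gplus: "gval (x \<oplus> y) = gval x * gval y"
  by (simp add: gval_def gplus_def exp_add)

lemma gval_gminus: "gval (x \<ominus> y) = gval x / gval y"
  by (simp add: gval_def gminus_def exp_diff)

definition gmod :: "gcomplex \<Rightarrow> real" where
  "gmod x = exp (cmod (gln x))"

text \<open>
  The set of all sequences is the whole type \<^typ>\<open>nat \<Rightarrow> gcomplex\<close>.  Sequences whose index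
  starts at 1 are shifted to start at 0, so \<open>x k\<close> is the term \<open>x\<^sub>k\<^sub>+\<^sub>1\<close>.
\<close>

definition linf_G :: "(nat \<Rightarrow> gcomplex) set" where
  "linf_G = {x. bdd_above (range (\<lambda>k. gmod (x k)))}"

definition c_G :: "(nat \<Rightarrow> gcomplex) set" where
  "c_G = {x. \<exists>l. (\<lambda>k. gmod (x k \<ominus> l)) \<longlonglongrightarrow> 1}"

definition c0_G :: "(nat \<Rightarrow> gcomplex) set" where
  "c0_G = {x. (\<lambda>k. gmod (x k)) \<longlonglongrightarrow> 1}"

primrec Delta_G :: "nat \<Rightarrow> (nat \<Rightarrow> gcomplex) \<Rightarrow> nat \<Rightarrow> gcomplex" where
  "Delta_G 0 x = x"
| "Delta_G (Suc m) x = (\<lambda>k. Delta_G m x k \<ominus> Delta_G m x (Suc k))"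

definition diff_space :: "(nat \<Rightarrow> gcomplex) set \<Rightarrow> nat \<Rightarrow> (nat \<Rightarrow> gcomplex) set" where
  "diff_space X m = {x. Delta_G m x \<in> X}"

end

theory Submission imports Defs begin

text \<open>
  In terms of exponents, the operator \<open>\<Delta>\<close> is surjective on sequences (sum up a prescribed
  difference sequence), and so is every power \<open>\<Delta>\<^sup>m\<close>.  Since \<open>\<Delta>\<^sup>m\<^sup>+\<^sup>1 = \<Delta> \<circ> \<Delta>\<^sup>m\<close>,
  each strict inclusion reduces to its instance \<open>m = 0\<close>, where the exponent sequences \<open>1\<close>
  (for \<open>c\<^sub>0\<close>) and \<open>k\<close> (for \<open>c\<close> and \<open>l\<^sub>\<infinity>\<close>) show strictness.
\<close>

lemma surj_Delta_G: "surj (Delta_G m)"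
proof (induction m)
  case 0
  then show ?case by auto
next
  case (Suc m)
  show ?case
    unfolding surj_def
  proof
    fix y :: "nat \<Rightarrow> gcomplex"
    \<comment> \<open>The minus sign matches the forward convention:
      \<open>gln (s k) - gln (s (Suc k))\<close> telescopes to \<open>gln (y k)\<close>.\<close>
    define s where "s = (\<lambda>k. GExp (- (\<Sum>i<k. gln (y i))))"
    obtain x where "Delta_G m x = s"
      using Suc by (metis surjD)
    then have "y = Delta_G (Suc m) x"
      by (simp add: s_def gminus_def fun_eq_iff)
    then show "\<exists>x. y = Delta_G (Suc m) x"
      by blast
  qed
qed

text \<open>Both sides are preimages under the surjection \<open>Delta_G m\<close>, of
  \<open>X\<close> and of \<open>diff_space X 1\<close>, and such preimages preserve strict
  inclusion.\<close>

lemma diff_space_strict_mono: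
  assumes "X \<subset> diff_space X 1"
  shows "diff_space X m \<subset> diff_space X (m + 1)"
proof -
  have vimage: "diff_space X m = Delta_G m -` X"
    "diff_space X (m + 1) = Delta_G m -` diff_space X 1"
    by (auto simp: diff_space_def)
  obtain y where y: "y \<in> diff_space X 1" "y \<notin> X"
    using assms by blast
  obtain x where "Delta_G m x = y"
    using surj_Delta_G[of m] by (metis surjD)
  with y have "x \<in> diff_space X (m + 1)" "x \<notin> diff_space X m"
    unfolding vimage by auto
  moreover have "diff_space X m \<subseteq> diff_space X (m + 1)"
    unfolding vimage using assms by auto
  ultimately show ?thesis by blast
qed

text \<open>Continuity of \<open>ln\<close> at 1 and of \<open>exp\<close> at 0 turns geometric
  convergence into ordinary convergence of exponents.\<close>

lemma gmod_tendsto_1_iff: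
  "((\<lambda>k. gmod (x k)) \<longlonglongrightarrow> 1) \<longleftrightarrow> ((\<lambda>k. gln (x k)) \<longlonglongrightarrow> 0)"
proof
  assume "(\<lambda>k. gmod (x k)) \<longlonglongrightarrow> 1"
  from tendsto_ln[OF this] show "(\<lambda>k. gln (x k)) \<longlonglongrightarrow> 0"
    by (simp add: gmod_def tendsto_norm_zero_iff)
next
  assume "(\<lambda>k. gln (x k)) \<longlonglongrightarrow> 0"
  from tendsto_exp[OF tendsto_norm_zero[OF this]] show "(\<lambda>k. gmod (x k)) \<longlonglongrightarrow> 1"
    by (simp add: gmod_def)
qed

lemma c0_G_iff: "x \<in> c0_G \<longleftrightarrow> (\<lambda>k. gln (x k)) \<longlonglongrightarrow> 0"
  by (simp add: c0_G_def gmod_tendsto_1_iff)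

lemma c_G_iff: "x \<in> c_G \<longleftrightarrow> convergent (\<lambda>k. gln (x k))"
proof -
  have "x \<in> c_G \<longleftrightarrow> (\<exists>l. (\<lambda>k. gln (x k)) \<longlonglongrightarrow> gln l)"
    by (simp add: c_G_def gmod_tendsto_1_iff gminus_def LIM_zero_iff)
  \<comment> \<open>Every complex number is \<open>gln l\<close> for some \<open>l\<close>, so the
    limit is unrestricted.\<close>
  then show ?thesis
    unfolding convergent_def by (metis gcomplex.sel)
qed

lemma linf_G_iff: "x \<in> linf_G \<longleftrightarrow> Bseq (\<lambda>k. gln (x k))"
proof
  assume "x \<in> linf_G"
  then obtain M where M: "\<And>k. gmod (x k) \<le> M"
    by (auto simp: linf_G_def bdd_above_def)
  have "cmod (gln (x k)) \<le> ln M" for k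
  proof -
    have "0 < M"
      using M[of k] by (simp add: gmod_def) (meson exp_gt_zero less_le_trans)
    then show ?thesis
      using M[of k] by (simp add: gmod_def ln_ge_iff)
  qed
  then show "Bseq (\<lambda>k. gln (x k))"
    by (rule BseqI')
next
  assume "Bseq (\<lambda>k. gln (x k))"
  then obtain K where "\<And>k. cmod (gln (x k)) \<le> K"
    unfolding Bseq_def by blast
  then show "x \<in> linf_G"
    by (auto simp: linf_G_def gmod_def intro!: bdd_aboveI2)
qed

text \<open>The explicit \<open>GExp\<close> lets the exponent criteria for the three spaces apply
  directly to the difference sequence.\<close>

lemma mem_diff_space_1_iff:
  "x \<in> diff_space X 1 \<longleftrightarrow> (\<lambda>k. GExp (gln (x k) - gln (x (Suc k)))) \<in> X"
  by (simp add: diff_space_def gminus_def)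

lemma not_Bseq_of_nat: "\<not> Bseq (of_nat :: nat \<Rightarrow> complex)"
proof
  assume "Bseq (of_nat :: nat \<Rightarrow> complex)"
  then obtain K where "\<And>n. real n \<le> K"
    unfolding Bseq_def by auto
  then show False
    using reals_Archimedean2[of K] by (meson not_le)
qed

lemma c0_G_psubset: "c0_G \<subset> diff_space c0_G 1"
proof (rule psubsetI)
  show "c0_G \<subseteq> diff_space c0_G 1"
  proof
    fix x assume "x \<in> c0_G"
    then have "(\<lambda>k. gln (x k)) \<longlonglongrightarrow> 0"
      by (simp add: c0_G_iff)
    from tendsto_diff[OF this LIMSEQ_Suc[OF this]] show "x \<in> diff_space c0_G 1"
      by (simp only: mem_diff_space_1_iff c0_G_iff) simp
  qed
  \<comment> \<open>The exponents have differences 0 but limit 1.\<close>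
  have "(\<lambda>k. GExp 1) \<in> diff_space c0_G 1 - c0_G"
    by (simp only: mem_diff_space_1_iff c0_G_iff Diff_iff) (simp add: LIMSEQ_const_iff)
  then show "c0_G \<noteq> diff_space c0_G 1" by blast
qed

lemma c_G_psubset: "c_G \<subset> diff_space c_G 1"
proof (rule psubsetI)
  show "c_G \<subseteq> diff_space c_G 1"
  proof
    fix x assume "x \<in> c_G"
    then have *: "convergent (\<lambda>k. gln (x k))"
      by (simp add: c_G_iff)
    then have "convergent (\<lambda>k. gln (x (Suc k)))"
      by (rule iffD2[OF convergent_Suc_iff])
    from convergent_diff[OF * this] show "x \<in> diff_space c_G 1"
      by (simp only: mem_diff_space_1_iff c_G_iff) simp
  qed
  have "\<not> convergent (of_nat :: nat \<Rightarrow> complex)"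
    using not_Bseq_of_nat convergent_imp_Bseq by blast
  \<comment> \<open>The exponents \<open>of_nat k\<close> have constant difference -1, a convergent
    sequence, but diverge themselves.\<close>
  then have "(\<lambda>k. GExp (of_nat k)) \<in> diff_space c_G 1 - c_G"
    by (simp only: mem_diff_space_1_iff c_G_iff Diff_iff) (simp add: convergent_const)
  then show "c_G \<noteq> diff_space c_G 1" by blast
qed

lemma linf_G_psubset: "linf_G \<subset> diff_space linf_G 1"
proof (rule psubsetI)
  show "linf_G \<subseteq> diff_space linf_G 1"
  proof
    fix x assume "x \<in> linf_G"
    then obtain K where K: "\<And>k. cmod (gln (x k)) \<le> K"
      unfolding linf_G_iff Bseq_def by blast
    have "cmod (gln (x k) - gln (x (Suc k))) \<le> K + K" for k
      by (rule norm_triangle_le_diff) (intro add_mono K)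
    then have "Bseq (\<lambda>k. gln (x k) - gln (x (Suc k)))"
      by (rule BseqI')
    then show "x \<in> diff_space linf_G 1"
      by (simp only: mem_diff_space_1_iff linf_G_iff) simp
  qed
  \<comment> \<open>The same witness works here: constant differences are bounded, while
    \<open>of_nat k\<close> is not.\<close>
  have "(\<lambda>k. GExp (of_nat k)) \<in> diff_space linf_G 1 - linf_G"
    by (simp only: mem_diff_space_1_iff linf_G_iff Diff_iff) (simp add: not_Bseq_of_nat)
  then show "linf_G \<noteq> diff_space linf_G 1" by blast
qed

theorem lemma2p2:
  fixes m :: nat
  assumes "m \<ge> 1"
  shows "diff_space c0_G m \<subset> diff_space c0_G (m + 1)
    \<and> diff_space c_G m \<subset> diff_space c_G (m + 1)
    \<and> diff_space linf_G m \<subset> diff_space linf_G (m + 1)"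
  by (intro conjI diff_space_strict_mono c0_G_psubset c_G_psubset linf_G_psubset)

end
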